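(* $\mathrm{R}^0(\mathrm{lin})$ has polynomial upper bounds on interpolant circuits: for any pairwise disjoint variable vectors $\vec p$ ($n$ variables), $\vec q$ ($s$ variables), $\vec r$ ($t$ variables) and any collections $A_1(\vec p,\vec q),\dots,A_k(\vec p,\vec q)$ and $B_1(\vec p,\vec r),\dots,B_\ell(\vec p,\vec r)$ of disjunctions of linear equations in the displayed variables, if there is an $\mathrm{R}^0(\mathrm{lin})$ refutation of size $S$ of $A_1\wedge\dots\wedge A_k\wedge B_1\wedge\dots\wedge B_\ell$, then there is a Boolean circuit of size polynomial in $S$ separating $\mathcal U_A$ from $\mathcal V_B$.
   Context: Linear equations $\vec a\cdot\vec x=a_0$ have integer coefficients and size $\sum|a_i|$; disjunctions of linear equations are satisfied iff some equation holds; empty disjunction false; size = total size. Clause $\bigvee_{i\in I}x_i\vee\bigvee_{j\in J}\neg x_j$ translates to $\bigvee_{i\in I}(x_i=1)\vee\bigvee_{j\in J}(x_j=0)$. R(lin) proofs: lines initial, Boolean axioms $(x_h=0)\vee(x_h=1)$, or derived by Resolution (from $A\vee L_1$, $B\vee L_2$ derive $A\vee B\vee(L_1\pm L_2)$), Weakening (from $A$ derive $A\vee L$), Simplification (from $A\vee(0=k)$, $k\ne0$, derive $A$); refutation derives the empty disjunction. $\mathrm{R}^0(\mathrm{lin})$-line: variable coefficients bounded by a fixed constant (free terms unbounded), partitionable into a constant number of sub-disjunctions each of equations differing only in free terms or a translated clause; $\mathrm{R}^0(\mathrm{lin})$ = R(lin) restricted to such lines. $\mathcal U_A=\{u\in\{0,1\}^n:\exists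 q\in\{0,1\}^s,\ (u,q)\text{ satisfies all }A_i\}$, $\mathcal V_B=\{v\in\{0,1\}^n:\exists r\in\{0,1\}^t,\ (v,r)\text{ satisfies all }B_j\}$ (disjoint since the conjunction is unsatisfiable). A Boolean circuit $C$ separates $\mathcal U$ from $\mathcal V$ if $C=1$ on $\mathcal U$ and $C=0$ on $\mathcal V$. *)

theory Defs
  imports
    Main
    "HOL-Library.Poly_Mapping"
    "HOL-Library.Product_Plus"
    "HOL-Library.Disjoint_Sets"
    "HOL-Computational_Algebra.Polynomial"
begin

section \<open>Disjunctions of linear equations\<close>

text \<open>
  The pair \<open>(a, b)\<close> stands for the equation \<open>a \<cdot> x = b\<close>. Thus \<open>+\<close> and \<open>-\<close> on pairs are the sum
  and the difference of equations, taken on both sides.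
\<close>

type_synonym 'v lineq = "('v \<Rightarrow>\<^sub>0 int) \<times> int"

text \<open>
  A disjunction is a finite set of equations, so that repeated disjuncts are contracted.
  Finiteness is part of \<open>disj_over\<close>.
\<close>

type_synonym 'v disj = "'v lineq set"

definition disj_over :: "'v set \<Rightarrow> 'v disj \<Rightarrow> bool" where
  "disj_over X D \<longleftrightarrow> finite D \<and> (\<forall>(a, b) \<in> D. Poly_Mapping.keys a \<subseteq> X)"

definition lineq_size :: "'v lineq \<Rightarrow> nat" where
  "lineq_size L =
    (\<Sum>x \<in> Poly_Mapping.keys (fst L). nat \<bar>Poly_Mapping.lookup (fst L) x\<bar>) + nat \<bar>snd L\<bar>"

definition disj_size :: "'v disj \<Rightarrow> nat" where
  "disj_size D = (\<Sum>L \<in> D. lineq_size L)"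

definition sat_lineq :: "('v \<Rightarrow> int) \<Rightarrow> 'v lineq \<Rightarrow> bool" where
  "sat_lineq \<rho> L \<longleftrightarrow>
    (\<Sum>x \<in> Poly_Mapping.keys (fst L). Poly_Mapping.lookup (fst L) x * \<rho> x) = snd L"

definition sat_disj :: "('v \<Rightarrow> int) \<Rightarrow> 'v disj \<Rightarrow> bool" where
  "sat_disj \<rho> D \<longleftrightarrow> (\<exists>L \<in> D. sat_lineq \<rho> L)"

definition var_eq :: "'v \<Rightarrow> int \<Rightarrow> 'v lineq" where
  "var_eq x b = (Poly_Mapping.single x 1, b)"

text \<open>Translation of the clause with positive literals \<open>I\<close> and negative literals \<open>J\<close>.\<close>

definition clause_disj :: "'v set \<Rightarrow> 'v set \<Rightarrow> 'v disj" where
  "clause_disj I J = (\<lambda>i. var_eq i 1) ` I \<union> (\<lambda>j. var_eq j 0) ` J"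


section \<open>The proof systems R(lin) and R0(lin)\<close>

text \<open>
  \<open>Rlin_step X K Ds D\<close>: \<open>D\<close> is an initial disjunction from \<open>K\<close>, a Boolean axiom, or follows by
  one rule from members of \<open>Ds\<close>.
\<close>

inductive Rlin_step :: "'v set \<Rightarrow> 'v disj set \<Rightarrow> 'v disj set \<Rightarrow> 'v disj \<Rightarrow> bool"
  for X :: "'v set" and K :: "'v disj set" and Ds :: "'v disj set"
where
  initial: "D \<in> K \<Longrightarrow> Rlin_step X K Ds D"
| boolean: "x \<in> X \<Longrightarrow> Rlin_step X K Ds {var_eq x 0, var_eq x 1}"
| resolution_add: "insert L1 A \<in> Ds \<Longrightarrow> insert L2 B \<in> Ds \<Longrightarrow>
    Rlin_step X K Ds (insert (L1 + L2) (A \<union> B))"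
| resolution_sub: "insert L1 A \<in> Ds \<Longrightarrow> insert L2 B \<in> Ds \<Longrightarrow>
    Rlin_step X K Ds (insert (L1 - L2) (A \<union> B))"
| weakening: "A \<in> Ds \<Longrightarrow> Rlin_step X K Ds (insert L A)"
| simplification: "insert (0, k) A \<in> Ds \<Longrightarrow> k \<noteq> 0 \<Longrightarrow> Rlin_step X K Ds A"

text \<open>Requiring every line to be over \<open>X\<close> confines the weakening rule to equations over \<open>X\<close>.\<close>

definition Rlin_refutation :: "'v set \<Rightarrow> 'v disj set \<Rightarrow> 'v disj list \<Rightarrow> bool" where
  "Rlin_refutation X K \<pi> \<longleftrightarrow>
    (\<forall>i < length \<pi>. disj_over X (\<pi> ! i) \<and> Rlin_step X K (set (take i \<pi>)) (\<pi> ! i)) \<and>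
    \<pi> \<noteq> [] \<and> last \<pi> = {}"

definition proof_size :: "'v disj list \<Rightarrow> nat" where
  "proof_size \<pi> = (\<Sum>D \<leftarrow> \<pi>. disj_size D)"

text \<open>
  The two constants in the notion of an R0(lin)-line are parameters: \<open>c\<close> bounds the absolute values
  of the coefficients of variables, \<open>d\<close> bounds the number of sub-disjunctions.
\<close>

definition R0lin_line :: "nat \<Rightarrow> nat \<Rightarrow> 'v disj \<Rightarrow> bool" where
  "R0lin_line c d D \<longleftrightarrow>
    (\<forall>(a, b) \<in> D. \<forall>x. \<bar>Poly_Mapping.lookup a x\<bar> \<le> int c) \<and>
    (\<exists>P. partition_on D P \<and> card P \<le> d \<and>
      (\<forall>E \<in> P. (\<exists>a. \<forall>L \<in> E. fst L = a) \<or> (\<exists>I J. E = clause_disj I J)))"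

definition R0lin_refutation :: "nat \<Rightarrow> nat \<Rightarrow> 'v set \<Rightarrow> 'v disj set \<Rightarrow> 'v disj list \<Rightarrow> bool" where
  "R0lin_refutation c d X K \<pi> \<longleftrightarrow> Rlin_refutation X K \<pi> \<and> (\<forall>D \<in> set \<pi>. R0lin_line c d D)"


section \<open>Boolean circuits\<close>

text \<open>
  A circuit is a list of gates in topological order. Operands of a gate are positions of earlier
  gates, and the last gate is the output. Input variables that are read, and constants, are gates
  and count towards the size; inputs that are not read do not.
\<close>

datatype gate = Input_gate nat | Const_gate bool | Not_gate nat | And_gate nat nat | Or_gate nat nat

type_synonym circuit = "gate list"

fun gate_ok :: "nat \<Rightarrow> nat \<Rightarrow> gate \<Rightarrow> bool" where
  "gate_ok n m (Input_gate i) \<longleftrightarrow> i < n"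
| "gate_ok n m (Const_gate b) \<longleftrightarrow> True"
| "gate_ok n m (Not_gate i) \<longleftrightarrow> i < m"
| "gate_ok n m (And_gate i j) \<longleftrightarrow> i < m \<and> j < m"
| "gate_ok n m (Or_gate i j) \<longleftrightarrow> i < m \<and> j < m"

definition circuit_over :: "nat \<Rightarrow> circuit \<Rightarrow> bool" where
  "circuit_over n C \<longleftrightarrow> C \<noteq> [] \<and> (\<forall>m < length C. gate_ok n m (C ! m))"

fun gate_val :: "bool list \<Rightarrow> bool list \<Rightarrow> gate \<Rightarrow> bool" where
  "gate_val u vs (Input_gate i) = u ! i"
| "gate_val u vs (Const_gate b) = b"
| "gate_val u vs (Not_gate i) = (\<not> vs ! i)"
| "gate_val u vs (And_gate i j) = (vs ! i \<and> vs ! j)"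
| "gate_val u vs (Or_gate i j) = (vs ! i \<or> vs ! j)"

definition circuit_eval :: "circuit \<Rightarrow> bool list \<Rightarrow> bool" where
  "circuit_eval C u = last (foldl (\<lambda>vs g. vs @ [gate_val u vs g]) [] C)"

definition circuit_size :: "circuit \<Rightarrow> nat" where
  "circuit_size C = length C"

definition separates :: "circuit \<Rightarrow> bool list set \<Rightarrow> bool list set \<Rightarrow> bool" where
  "separates C U V \<longleftrightarrow> (\<forall>u \<in> U. circuit_eval C u) \<and> (\<forall>v \<in> V. \<not> circuit_eval C v)"


section \<open>The sets to be separated\<close>

text \<open>The 0/1 assignment of the bits \<open>bs\<close> to the variables \<open>xs\<close>; the value 0 elsewhere is a dummy.\<close>

definition assign :: "'v list \<Rightarrow> bool list \<Rightarrow> 'v \<Rightarrow> int" where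
  "assign xs bs x = (if map_of (zip xs bs) x = Some True then 1 else 0)"

text \<open>
  The vectors \<open>u\<close> of values for \<open>ps\<close> that extend, by values for \<open>ys\<close>, to a solution of all members
  of \<open>K\<close>. So \<open>\<U>\<^sub>A\<close> is \<open>extendable ps qs A\<close> and \<open>\<V>\<^sub>B\<close> is \<open>extendable ps rs B\<close>.
\<close>

definition extendable :: "'v list \<Rightarrow> 'v list \<Rightarrow> 'v disj set \<Rightarrow> bool list set" where
  "extendable ps ys K = {u. length u = length ps \<and>
    (\<exists>w. length w = length ys \<and> (\<forall>D \<in> K. sat_disj (assign (ps @ ys) (u @ w)) D))}"

end

theory Submission imports Defs begin

text \<open>
  Alice holds a solution \<open>(u, w)\<close> of the \<open>A\<close>-part and Bob a solution \<open>(v, z)\<close> of the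
  \<open>B\<close>-part. A line is judged at \<open>(u, w, z)\<close>; since the last line is false there, one can walk back
  through false lines to an initial line, which must come from \<open>B\<close>. An R0(lin)-line amounts to
  boundedly many linear forms: a common left-hand side, or, for a clause, the sum of its literals.
  Whether it is false thus depends only on the values of these forms on Alice's and on Bob's
  variables, and there are polynomially many vectors of such values. For each false line and each
  pair of vectors there is a function separating the corresponding \<open>u\<close> from the corresponding
  \<open>v\<close>. For an inference it is a disjunction over Alice's vectors for the premises of
  conjunctions over Bob's; for an initial line from \<open>B\<close> it is the falsity of the line at \<open>u\<close>
  and Bob's vector, computed by summing up the forms one variable at a time.
\<close>

section \<open>Families of Boolean functions computed by a circuit\<close>

text \<open>This is the fold inside \<open>circuit_eval\<close> before \<open>last\<close> is
  applied: every gate keeps its value, so each of them can serve as an output.\<close>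

definition gate_vals :: "bool list \<Rightarrow> circuit \<Rightarrow> bool list" where
  "gate_vals u C = foldl (\<lambda>vs g. vs @ [gate_val u vs g]) [] C"

lemma gate_vals_Nil [simp]: "gate_vals u [] = []"
  and gate_vals_snoc [simp]:
    "gate_vals u (C @ [g]) = gate_vals u C @ [gate_val u (gate_vals u C) g]"
  by (simp_all add: gate_vals_def)

lemma length_gate_vals [simp]: "length (gate_vals u C) = length C"
  by (induction C rule: rev_induct) simp_all

lemma gate_vals_take: "gate_vals u (take m C) = take m (gate_vals u C)"
proof (induction C rule: rev_induct)
  case (snoc g C)
  then show ?case by (cases "m \<le> length C") simp_all
qed simp

text \<open>A whole family shares one gate list. An inference can then use the separators of its
  premises as gates, whereas copying them at every use could blow up exponentially.\<close>

definition realizable :: "nat \<Rightarrow> (bool list \<Rightarrow> bool) set \<Rightarrow> nat \<Rightarrow> bool" where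
  "realizable n F k \<longleftrightarrow> (\<exists>C. (\<forall>m < length C. gate_ok n m (C ! m)) \<and> length C \<le> k \<and>
    (\<forall>f \<in> F. \<exists>m < length C. \<forall>u. length u = n \<longrightarrow> gate_vals u C ! m = f u))"

lemma realizable_empty: "realizable n {} 0"
  unfolding realizable_def by (rule exI[of _ "[]"]) simp

lemma realizable_mono: "realizable n F k \<Longrightarrow> G \<subseteq> F \<Longrightarrow> k \<le> l \<Longrightarrow> realizable n G l"
  unfolding realizable_def by (elim exE, rule exI) auto

lemma realizable_circuit:
  assumes "realizable n F k" "f \<in> F"
  obtains C where "circuit_over n C" "circuit_size C \<le> k"
    "\<And>u. length u = n \<Longrightarrow> circuit_eval C u = f u"
proof -
  obtain C m where C: "\<forall>m < length C. gate_ok n m (C ! m)" "length C \<le> k" "m < length C"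
    "\<forall>u. length u = n \<longrightarrow> gate_vals u C ! m = f u"
    using assms unfolding realizable_def by blast
  \<comment> \<open>The output is the last gate, so cutting the list right after gate
    \<open>m\<close> makes that gate the output. Operands point backwards, so the prefix stays well
    formed.\<close>
  have "circuit_eval (take (Suc m) C) u = f u" if "length u = n" for u
  proof -
    have "circuit_eval (take (Suc m) C) u = last (take (Suc m) (gate_vals u C))"
      unfolding circuit_eval_def gate_vals_def[symmetric] gate_vals_take ..
    also have "\<dots> = gate_vals u C ! m"
      using C(3) by (simp add: take_Suc_conv_app_nth)
    finally show ?thesis using C(4) that by simp
  qed
  moreover have "circuit_over n (take (Suc m) C)"
    using C(1,3) by (auto simp: circuit_over_def)
  moreover have "circuit_size (take (Suc m) C) \<le> k"
    using C(2) by (simp add: circuit_size_def)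
  ultimately show ?thesis using that by blast
qed

lemma realizable_gate:
  assumes "realizable n F k"
    and g: "\<And>C. \<forall>f \<in> F. \<exists>m < length C. \<forall>u. length u = n \<longrightarrow> gate_vals u C ! m = f u \<Longrightarrow>
      \<exists>g. gate_ok n (length C) g \<and>
        (\<forall>u. length u = n \<longrightarrow> gate_val u (gate_vals u C) g = h u)"
  shows "realizable n (insert h F) (k + 1)"
proof -
  obtain C where C: "\<forall>m < length C. gate_ok n m (C ! m)" "length C \<le> k"
    "\<forall>f \<in> F. \<exists>m < length C. \<forall>u. length u = n \<longrightarrow> gate_vals u C ! m = f u"
    using assms(1) unfolding realizable_def by blast
  obtain g where g: "gate_ok n (length C) g"
    "\<forall>u. length u = n \<longrightarrow> gate_val u (gate_vals u C) g = h u"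
    using g[OF C(3)] by blast
  have "\<exists>m < length (C @ [g]). \<forall>u. length u = n \<longrightarrow> gate_vals u (C @ [g]) ! m = f u"
    if "f \<in> insert h F" for f
  proof (cases "f = h")
    case True
    then show ?thesis using g(2) by (intro exI[of _ "length C"]) (simp add: nth_append)
  next
    case False
    with that C(3) obtain m where
      "m < length C" "\<forall>u. length u = n \<longrightarrow> gate_vals u C ! m = f u" by blast
    then show ?thesis by (intro exI[of _ m]) (simp add: nth_append)
  qed
  moreover have "\<forall>m < length (C @ [g]). gate_ok n m ((C @ [g]) ! m)"
    using C(1) g(1) by (auto simp: nth_append less_Suc_eq)
  ultimately show ?thesis
    unfolding realizable_def using C(2) by (intro exI[of _ "C @ [g]"]) simp
qed

text \<open>Cost relative to functions already present. Quantifying over every realizable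
  \<open>F\<close> above \<open>B\<close> makes costs add up under composition, and \<open>B\<close>
  is never paid for again.\<close>

definition adds :: "nat \<Rightarrow> (bool list \<Rightarrow> bool) set \<Rightarrow> (bool list \<Rightarrow> bool) set \<Rightarrow> nat \<Rightarrow> bool" where
  "adds n B H m \<longleftrightarrow> (\<forall>F k. B \<subseteq> F \<longrightarrow> realizable n F k \<longrightarrow> realizable n (F \<union> H) (k + m))"

lemma addsD: "adds n B H m \<Longrightarrow> B \<subseteq> F \<Longrightarrow> realizable n F k \<Longrightarrow> realizable n (F \<union> H) (k + m)"
  unfolding adds_def by blast

lemma adds_mono:
  assumes "adds n B H m" "B \<subseteq> B'" "H' \<subseteq> H" "m \<le> m'"
  shows "adds n B' H' m'"
  unfolding adds_def
proof (intro allI impI)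
  fix F k
  assume "B' \<subseteq> F" "realizable n F k"
  then have "realizable n (F \<union> H) (k + m)" using assms(1,2) by (auto dest: addsD)
  then show "realizable n (F \<union> H') (k + m')"
    by (rule realizable_mono) (use assms in auto)
qed

lemma adds_subset: "H \<subseteq> B \<Longrightarrow> adds n B H 0"
  unfolding adds_def by (simp add: Un_absorb2)

lemma adds_trans:
  assumes "adds n B H m" "adds n (B \<union> H) G m'"
  shows "adds n B (H \<union> G) (m + m')"
  unfolding adds_def
proof (intro allI impI)
  fix F k
  assume F: "B \<subseteq> F" "realizable n F k"
  then have "realizable n (F \<union> H) (k + m)" using assms(1) by (blast intro: addsD)
  then have "realizable n ((F \<union> H) \<union> G) ((k + m) + m')"
    using F(1) by (intro addsD[OF assms(2)]) auto
  then show "realizable n (F \<union> (H \<union> G)) (k + (m + m'))" by (simp add: Un_assoc add.assoc)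
qed

lemma adds_cut:
  assumes "adds n B H m" "adds n (B \<union> H) G m'"
  shows "adds n B G (m + m')"
  by (rule adds_mono[OF adds_trans[OF assms]]) auto

lemma adds_gate:
  assumes "\<And>C. \<forall>f \<in> B. \<exists>m < length C. \<forall>u. length u = n \<longrightarrow> gate_vals u C ! m = f u \<Longrightarrow>
      \<exists>g. gate_ok n (length C) g \<and>
        (\<forall>u. length u = n \<longrightarrow> gate_val u (gate_vals u C) g = h u)"
  shows "adds n B {h} 1"
  unfolding adds_def
proof (intro allI impI)
  fix F k
  assume "B \<subseteq> F" "realizable n F k"
  then have "realizable n (insert h F) (k + 1)"
    by (intro realizable_gate assms) auto
  then show "realizable n (F \<union> {h}) (k + 1)" by simp
qed

lemma adds_const: "adds n B {\<lambda>_. b} 1"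
  by (rule adds_gate, rule exI[of _ "Const_gate b"]) simp

lemma adds_not:
  assumes "adds n B {f} m"
  shows "adds n B {\<lambda>u. \<not> f u} (m + 1)"
proof (rule adds_cut[OF assms], rule adds_gate)
  fix C
  assume "\<forall>f \<in> B \<union> {f}. \<exists>m < length C. \<forall>u. length u = n \<longrightarrow> gate_vals u C ! m = f u"
  then obtain m where "m < length C" "\<forall>u. length u = n \<longrightarrow> gate_vals u C ! m = f u" by blast
  then show "\<exists>g. gate_ok n (length C) g \<and>
      (\<forall>u. length u = n \<longrightarrow> gate_val u (gate_vals u C) g = (\<not> f u))"
    by (intro exI[of _ "Not_gate m"]) simp
qed

lemma adds_and:
  assumes "adds n B {f} m" "adds n B {g} m'"
  shows "adds n B {\<lambda>u. f u \<and> g u} (m + m' + 1)"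
proof -
  have "adds n B ({f} \<union> {g}) (m + m')"
    by (rule adds_trans[OF assms(1)], rule adds_mono[OF assms(2)]) auto
  then show ?thesis
  proof (rule adds_cut[OF _ adds_gate])
    fix C
    assume C: "\<forall>f \<in> B \<union> ({f} \<union> {g}).
      \<exists>m < length C. \<forall>u. length u = n \<longrightarrow> gate_vals u C ! m = f u"
    then obtain i where "i < length C" "\<forall>u. length u = n \<longrightarrow> gate_vals u C ! i = f u" by blast
    moreover from C obtain j
      where "j < length C" "\<forall>u. length u = n \<longrightarrow> gate_vals u C ! j = g u" by blast
    ultimately show "\<exists>h. gate_ok n (length C) h \<and>
        (\<forall>u. length u = n \<longrightarrow> gate_val u (gate_vals u C) h = (f u \<and> g u))"
      by (intro exI[of _ "And_gate i j"]) simp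
  qed
qed

lemma adds_or:
  assumes "adds n B {f} m" "adds n B {g} m'"
  shows "adds n B {\<lambda>u. f u \<or> g u} (m + m' + 1)"
proof -
  have "adds n B ({f} \<union> {g}) (m + m')"
    by (rule adds_trans[OF assms(1)], rule adds_mono[OF assms(2)]) auto
  then show ?thesis
  proof (rule adds_cut[OF _ adds_gate])
    fix C
    assume C: "\<forall>f \<in> B \<union> ({f} \<union> {g}).
      \<exists>m < length C. \<forall>u. length u = n \<longrightarrow> gate_vals u C ! m = f u"
    then obtain i where "i < length C" "\<forall>u. length u = n \<longrightarrow> gate_vals u C ! i = f u" by blast
    moreover from C obtain j
      where "j < length C" "\<forall>u. length u = n \<longrightarrow> gate_vals u C ! j = g u" by blast
    ultimately show "\<exists>h. gate_ok n (length C) h \<and>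
        (\<forall>u. length u = n \<longrightarrow> gate_val u (gate_vals u C) h = (f u \<or> g u))"
      by (intro exI[of _ "Or_gate i j"]) simp
  qed
qed

text \<open>Each index pays for its own function and for one conjunction gate; the final 1 is the
  constant \<open>True\<close> from which the iteration starts.\<close>

lemma adds_ball:
  assumes "finite I" "\<And>i. i \<in> I \<Longrightarrow> adds n B {f i} m"
  shows "adds n B {\<lambda>u. \<forall>i \<in> I. f i u} (card I * (m + 1) + 1)"
  using assms
proof (induction I rule: finite_induct)
  case empty
  then show ?case using adds_const[of n B True] by simp
next
  case (insert i I)
  then have "adds n B {\<lambda>u. f i u \<and> (\<forall>i \<in> I. f i u)} (m + (card I * (m + 1) + 1) + 1)"
    by (intro adds_and) auto
  then show ?case using insert.hyps by (simp add: algebra_simps)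
qed

lemma adds_bex:
  assumes "finite I" "\<And>i. i \<in> I \<Longrightarrow> adds n B {f i} m"
  shows "adds n B {\<lambda>u. \<exists>i \<in> I. f i u} (card I * (m + 1) + 1)"
  using assms
proof (induction I rule: finite_induct)
  case empty
  then show ?case using adds_const[of n B False] by simp
next
  case (insert i I)
  then have "adds n B {\<lambda>u. f i u \<or> (\<exists>i \<in> I. f i u)} (m + (card I * (m + 1) + 1) + 1)"
    by (intro adds_or) auto
  then show ?case using insert.hyps by (simp add: algebra_simps)
qed

lemma adds_image:
  assumes "finite I" "\<And>i. i \<in> I \<Longrightarrow> adds n B {f i} m"
  shows "adds n B (f ` I) (card I * m)"
  using assms
proof (induction I rule: finite_induct)
  case empty
  then show ?case by (simp add: adds_subset)
next
  case (insert i I)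
  have "adds n (B \<union> {f i}) (f ` I) (card I * m)"
    by (rule adds_mono[of n B]) (use insert in auto)
  then have "adds n B ({f i} \<union> f ` I) (m + card I * m)"
    using insert.prems by (intro adds_trans) auto
  then show ?case using insert.hyps by simp
qed

text \<open>
  One round of a communication game: if every class of \<open>\<alpha>\<close> on the one side is separated from
  every class of \<open>\<beta>\<close> on the other, then the disjunction over the first of the conjunctions over
  the second separates the two sides.
\<close>

lemma adds_separator:
  assumes "finite T" "finite T'" "\<alpha> ` X \<subseteq> T" "\<beta> ` Y \<subseteq> T'"
    and sep: "\<And>x y. x \<in> X \<Longrightarrow> y \<in> Y \<Longrightarrow>
      \<exists>g \<in> B. (\<forall>x' \<in> X. \<alpha> x' = \<alpha> x \<longrightarrow> g (i x')) \<and> (\<forall>y' \<in> Y. \<beta> y' = \<beta> y \<longrightarrow> \<not> g (j y'))"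
  obtains f where "adds n B {f} (card T * (card T' + 2) + 1)"
    "\<And>x. x \<in> X \<Longrightarrow> f (i x)" "\<And>y. y \<in> Y \<Longrightarrow> \<not> f (j y)"
proof -
  have "\<exists>g \<in> B. (\<forall>x' \<in> X. \<alpha> x' = a \<longrightarrow> g (i x')) \<and> (\<forall>y' \<in> Y. \<beta> y' = b \<longrightarrow> \<not> g (j y'))"
    if "a \<in> \<alpha> ` X" "b \<in> \<beta> ` Y" for a b
    using that sep by blast
  then obtain G where G: "\<And>a b. a \<in> \<alpha> ` X \<Longrightarrow> b \<in> \<beta> ` Y \<Longrightarrow> G a b \<in> B \<and>
      (\<forall>x' \<in> X. \<alpha> x' = a \<longrightarrow> G a b (i x')) \<and> (\<forall>y' \<in> Y. \<beta> y' = b \<longrightarrow> \<not> G a b (j y'))"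
    by metis
  define f where "f = (\<lambda>u. \<exists>a \<in> \<alpha> ` X. \<forall>b \<in> \<beta> ` Y. G a b u)"
  have fin: "finite (\<alpha> ` X)" "finite (\<beta> ` Y)" using assms by (auto intro: finite_subset)
  \<comment> \<open>The functions \<open>G a b\<close> belong to \<open>B\<close>, hence the cost 0
    for each of them.\<close>
  have "adds n B {\<lambda>u. \<forall>b \<in> \<beta> ` Y. G a b u} (card (\<beta> ` Y) * (0 + 1) + 1)" if "a \<in> \<alpha> ` X" for a
    using G that by (intro adds_ball fin adds_subset) auto
  then have "adds n B {f} (card (\<alpha> ` X) * ((card (\<beta> ` Y) * (0 + 1) + 1) + 1) + 1)"
    unfolding f_def by (intro adds_bex fin)
  moreover have "card (\<alpha> ` X) \<le> card T" "card (\<beta> ` Y) \<le> card T'"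
    using assms by (auto intro: card_mono)
  then have "card (\<alpha> ` X) * ((card (\<beta> ` Y) * (0 + 1) + 1) + 1) + 1 \<le> card T * (card T' + 2) + 1"
    by (intro add_mono[OF mult_le_mono]) auto
  ultimately have "adds n B {f} (card T * (card T' + 2) + 1)"
    by (auto elim: adds_mono)
  moreover have "f (i x)" if "x \<in> X" for x
    unfolding f_def using that G by blast
  moreover have "\<not> f (j y)" if "y \<in> Y" for y
    unfolding f_def using that G by blast
  ultimately show ?thesis by (rule that)
qed

section \<open>Linear forms\<close>

definition lin_val :: "('v \<Rightarrow>\<^sub>0 int) \<Rightarrow> ('v \<Rightarrow> int) \<Rightarrow> int" where
  "lin_val a \<rho> = (\<Sum>x \<in> Poly_Mapping.keys a. Poly_Mapping.lookup a x * \<rho> x)"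

definition lin_norm :: "('v \<Rightarrow>\<^sub>0 int) \<Rightarrow> nat" where
  "lin_norm a = (\<Sum>x \<in> Poly_Mapping.keys a. nat \<bar>Poly_Mapping.lookup a x\<bar>)"

lemma sat_lineq_iff: "sat_lineq \<rho> L \<longleftrightarrow> lin_val (fst L) \<rho> = snd L"
  by (simp add: sat_lineq_def lin_val_def)

lemma lineq_size_eq: "lineq_size L = lin_norm (fst L) + nat \<bar>snd L\<bar>"
  by (simp add: lineq_size_def lin_norm_def)

lemma lin_val_superset:
  assumes "finite X" "Poly_Mapping.keys a \<subseteq> X"
  shows "lin_val a \<rho> = (\<Sum>x \<in> X. Poly_Mapping.lookup a x * \<rho> x)"
  unfolding lin_val_def by (rule sum.mono_neutral_left) (use assms in \<open>auto simp: in_keys_iff\<close>)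

lemma lin_norm_superset:
  assumes "finite X" "Poly_Mapping.keys a \<subseteq> X"
  shows "lin_norm a = (\<Sum>x \<in> X. nat \<bar>Poly_Mapping.lookup a x\<bar>)"
  unfolding lin_norm_def by (rule sum.mono_neutral_left) (use assms in \<open>auto simp: in_keys_iff\<close>)

lemma lin_val_add: "lin_val (a + b) \<rho> = lin_val a \<rho> + lin_val b \<rho>"
proof -
  let ?X = "Poly_Mapping.keys a \<union> Poly_Mapping.keys b"
  have "lin_val c \<rho> = (\<Sum>x \<in> ?X. Poly_Mapping.lookup c x * \<rho> x)" if "c \<in> {a, b, a + b}" for c
    by (rule lin_val_superset) (use that Poly_Mapping.keys_add[of a b] in auto)
  then show ?thesis by (simp add: lookup_add algebra_simps sum.distrib)
qed

lemma lin_val_diff: "lin_val (a - b) \<rho> = lin_val a \<rho> - lin_val b \<rho>"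
  using lin_val_add[of "a - b" b \<rho>] by simp

lemma lin_val_assign_add: "lin_val a (\<lambda>x. \<rho> x + \<sigma> x) = lin_val a \<rho> + lin_val a \<sigma>"
  by (simp add: lin_val_def algebra_simps sum.distrib)

lemma lin_val_zero [simp]: "lin_val 0 \<rho> = 0"
  by (simp add: lin_val_def)

lemma lin_val_single [simp]: "lin_val (Poly_Mapping.single x 1) \<rho> = \<rho> x"
  by (simp add: lin_val_def)

lemma lin_norm_diff_le: "lin_norm (a - b) \<le> lin_norm a + lin_norm b"
proof -
  let ?X = "Poly_Mapping.keys a \<union> Poly_Mapping.keys b"
  have "lin_norm c = (\<Sum>x \<in> ?X. nat \<bar>Poly_Mapping.lookup c x\<bar>)" if "c \<in> {a, b, a - b}" for c
    by (rule lin_norm_superset) (use that Poly_Mapping.keys_diff[of a b] in auto)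
  then show ?thesis by (auto simp: lookup_minus sum.distrib[symmetric] intro!: sum_mono)
qed

lemma lin_norm_add_le: "lin_norm (a + b) \<le> lin_norm a + lin_norm b"
proof -
  let ?X = "Poly_Mapping.keys a \<union> Poly_Mapping.keys b"
  have "lin_norm c = (\<Sum>x \<in> ?X. nat \<bar>Poly_Mapping.lookup c x\<bar>)" if "c \<in> {a, b, a + b}" for c
    by (rule lin_norm_superset) (use that Poly_Mapping.keys_add[of a b] in auto)
  then show ?thesis by (auto simp: lookup_add sum.distrib[symmetric] intro!: sum_mono)
qed

lemma sum_single:
  fixes I :: "'v set"
  assumes "finite I"
  shows lin_val_sum_single: "lin_val (\<Sum>i \<in> I. Poly_Mapping.single i 1) \<rho> = (\<Sum>i \<in> I. \<rho> i)"
    and lin_norm_sum_single: "lin_norm (\<Sum>i \<in> I. Poly_Mapping.single i 1) \<le> card I"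
proof -
  show "lin_val (\<Sum>i \<in> I. Poly_Mapping.single i 1) \<rho> = (\<Sum>i \<in> I. \<rho> i)"
    using assms by induction (simp_all add: lin_val_add)
  show "lin_norm (\<Sum>i \<in> I. Poly_Mapping.single i 1) \<le> card I"
    using assms
  proof induction
    case (insert i I)
    have "lin_norm (Poly_Mapping.single i 1) = 1" by (simp add: lin_norm_def)
    then show ?case
      using insert lin_norm_add_le[of "Poly_Mapping.single i 1" "\<Sum>i \<in> I. Poly_Mapping.single i 1"]
      by simp
  qed (simp add: lin_norm_def)
qed

section \<open>Linear forms at binary assignments\<close>

definition binary :: "('v \<Rightarrow> int) \<Rightarrow> bool" where
  "binary \<rho> \<longleftrightarrow> (\<forall>x. \<rho> x = 0 \<or> \<rho> x = 1)"

lemma binary_assign [simp]: "binary (assign xs bs)"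
  by (simp add: binary_def assign_def)

lemma abs_lin_val_le:
  assumes "binary \<rho>"
  shows "\<bar>lin_val a \<rho>\<bar> \<le> int (lin_norm a)"
proof -
  have "\<bar>lin_val a \<rho>\<bar> \<le> (\<Sum>x \<in> Poly_Mapping.keys a. \<bar>Poly_Mapping.lookup a x * \<rho> x\<bar>)"
    unfolding lin_val_def by (rule sum_abs)
  also have "\<dots> \<le> (\<Sum>x \<in> Poly_Mapping.keys a. \<bar>Poly_Mapping.lookup a x\<bar>)"
  proof (rule sum_mono)
    fix x
    show "\<bar>Poly_Mapping.lookup a x * \<rho> x\<bar> \<le> \<bar>Poly_Mapping.lookup a x\<bar>"
      using assms by (cases "\<rho> x = 0") (auto simp: binary_def)
  qed
  also have "\<dots> = int (lin_norm a)" by (simp add: lin_norm_def)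
  finally show ?thesis .
qed

lemma card_keys_le_lin_norm: "card (Poly_Mapping.keys a) \<le> lin_norm a"
proof -
  have "card (Poly_Mapping.keys a) = (\<Sum>x \<in> Poly_Mapping.keys a. 1)" by simp
  also have "\<dots> \<le> lin_norm a"
    unfolding lin_norm_def by (intro sum_mono) (auto simp: in_keys_iff)
  finally show ?thesis .
qed

lemma adds_assign:
  assumes "distinct ps"
  shows "adds (length ps) B {\<lambda>u. assign ps u x = 1} 1"
proof (cases "x \<in> set ps")
  case True
  then obtain i where i: "i < length ps" "ps ! i = x" by (auto simp: in_set_conv_nth)
  show ?thesis
  proof (rule adds_gate, rule exI[of _ "Input_gate i"], intro conjI allI impI)
    fix C and u :: "bool list"
    assume u: "length u = length ps"
    then have "map_of (zip ps u) (ps ! i) = Some (u ! i)"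
      using assms i(1) by (intro map_of_zip_nth) auto
    then show "gate_val u (gate_vals u C) (Input_gate i) = (assign ps u x = 1)"
      using i by (simp add: assign_def)
  qed (use i in simp)
next
  case False
  \<comment> \<open>Outside \<open>ps\<close> the dummy value is 0, so a constant gate replaces the
    input gate.\<close>
  then have "(\<lambda>u. assign ps u x = 1) = (\<lambda>_. False)"
    by (auto simp: assign_def fun_eq_iff dest: map_of_SomeD set_zip_leftD)
  then show ?thesis using adds_const by metis
qed

text \<open>
  Dynamic programming over the variables of the form. All values outside the range of the form
  give the constant \<open>False\<close>, so that the infinite family needs finitely many gates.
\<close>

lemma adds_lin_val:
  assumes "distinct ps"
  shows "adds (length ps) {} (range (\<lambda>s u. lin_val a (assign ps u) = s))
    ((lin_norm a + 1) * (12 * lin_norm a + 8))"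
proof -
  let ?n = "length ps"
  let ?S = "lin_norm a"
  define f where "f X s u \<longleftrightarrow> (\<Sum>x \<in> X. Poly_Mapping.lookup a x * assign ps u x) = s"
    for X s u
  have bound: "\<bar>\<Sum>x \<in> X. Poly_Mapping.lookup a x * assign ps u x\<bar> \<le> int ?S"
    if "X \<subseteq> Poly_Mapping.keys a" for X u
  proof -
    have "\<bar>\<Sum>x \<in> X. Poly_Mapping.lookup a x * assign ps u x\<bar>
        \<le> (\<Sum>x \<in> X. \<bar>Poly_Mapping.lookup a x * assign ps u x\<bar>)"
      by (rule sum_abs)
    also have "\<dots> \<le> (\<Sum>x \<in> X. \<bar>Poly_Mapping.lookup a x\<bar>)"
      by (intro sum_mono) (simp add: assign_def)
    also have "\<dots> \<le> (\<Sum>x \<in> Poly_Mapping.keys a. \<bar>Poly_Mapping.lookup a x\<bar>)"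
      using that by (intro sum_mono2) auto
    finally show ?thesis by (simp add: lin_norm_def)
  qed
  have "adds ?n {} (range (f X)) ((card X + 1) * (12 * ?S + 8))"
    if "finite X" "X \<subseteq> Poly_Mapping.keys a" for X
    using that
  proof (induction X rule: finite_induct)
    case empty
    have "range (f {}) \<subseteq> {\<lambda>_. True} \<union> {\<lambda>_. False}"
      by (auto simp: f_def fun_eq_iff)
    moreover have "adds ?n {} ({\<lambda>_. True} \<union> {\<lambda>_. False}) (1 + 1)"
      by (intro adds_trans adds_const)
    ultimately show ?case by (elim adds_mono) auto
  next
    case (insert x X)
    let ?B = "range (f X)"
    define lit where "lit = (\<lambda>u. assign ps u x = 1)"
    define c where "c = Poly_Mapping.lookup a x"
    \<comment> \<open>Case distinction on the new variable: if it is 1, the other variables must sum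
      to \<open>s - c\<close>, otherwise to \<open>s\<close>.\<close>
    have eq: "f (insert x X) s = (\<lambda>u. lit u \<and> f X (s - c) u \<or> \<not> lit u \<and> f X s u)" for s
      using insert.hyps by (auto simp: fun_eq_iff f_def lit_def c_def assign_def)
    \<comment> \<open>One gate for the first conjunction, two for the negation and the second one,
      and one for the disjunction: four per target value. With \<open>2 * ?S + 1\<close> targets,
      the constant \<open>False\<close> and the literal this gives \<open>8 * ?S + 6\<close>, within
      the claimed increment \<open>12 * ?S + 8\<close>.\<close>
    have "adds ?n (?B \<union> {lit}) {f (insert x X) s} ((0 + 0 + 1) + ((0 + 1) + 0 + 1) + 1)" for s
      unfolding eq by (intro adds_or adds_and adds_not adds_subset) auto
    then have "adds ?n (?B \<union> {lit}) (f (insert x X) ` {- int ?S..int ?S})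
        (card {- int ?S..int ?S} * ((0 + 0 + 1) + ((0 + 1) + 0 + 1) + 1))"
      by (intro adds_image) auto
    then have "adds ?n (?B \<union> {lit}) ({\<lambda>_. False} \<union> f (insert x X) ` {- int ?S..int ?S})
        (1 + card {- int ?S..int ?S} * ((0 + 0 + 1) + ((0 + 1) + 0 + 1) + 1))"
      by (intro adds_trans[OF adds_const]) (auto elim: adds_mono)
    moreover have "range (f (insert x X)) \<subseteq>
        {\<lambda>_. False} \<union> f (insert x X) ` {- int ?S..int ?S}"
    proof
      fix g
      assume "g \<in> range (f (insert x X))"
      then obtain s where g: "g = f (insert x X) s" by blast
      show "g \<in> {\<lambda>_. False} \<union> f (insert x X) ` {- int ?S..int ?S}"
      proof (cases "s \<in> {- int ?S..int ?S}")
        case False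
        then have "\<not> g u" for u
          using bound[OF insert.prems, of u] unfolding g f_def by auto
        then show ?thesis by (auto simp: fun_eq_iff)
      qed (use g in blast)
    qed
    ultimately have "adds ?n (?B \<union> {lit}) (range (f (insert x X)))
        (1 + card {- int ?S..int ?S} * ((0 + 0 + 1) + ((0 + 1) + 0 + 1) + 1))"
      by (elim adds_mono) auto
    then have "adds ?n ?B (range (f (insert x X)))
        (1 + (1 + card {- int ?S..int ?S} * ((0 + 0 + 1) + ((0 + 1) + 0 + 1) + 1)))"
      using adds_assign[OF assms, of ?B x] unfolding lit_def by (rule adds_cut[rotated])
    then have "adds ?n ({} \<union> ?B) (range (f (insert x X)))
        (1 + (1 + card {- int ?S..int ?S} * ((0 + 0 + 1) + ((0 + 1) + 0 + 1) + 1)))"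
      by simp
    moreover have "adds ?n {} ?B ((card X + 1) * (12 * ?S + 8))"
      using insert.IH insert.prems by blast
    ultimately have "adds ?n {} (range (f (insert x X))) ((card X + 1) * (12 * ?S + 8) +
        (1 + (1 + card {- int ?S..int ?S} * ((0 + 0 + 1) + ((0 + 1) + 0 + 1) + 1))))"
      by (rule adds_cut[rotated])
    then show ?case by (rule adds_mono) (use insert.hyps in \<open>auto simp: nat_add_distrib\<close>)
  qed
  from this[of "Poly_Mapping.keys a"]
  have "adds ?n {} (range (\<lambda>s u. lin_val a (assign ps u) = s))
      ((card (Poly_Mapping.keys a) + 1) * (12 * ?S + 8))"
    by (simp add: f_def[abs_def] lin_val_def)
  then show ?thesis
    by (rule adds_mono) (use card_keys_le_lin_norm[of a] in \<open>auto intro!: mult_le_mono\<close>)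
qed

section \<open>Lines as systems of linear forms\<close>

text \<open>The second component is the set of values of the form that satisfy the line. It may be
  infinite, which covers blocks with a common left-hand side and clauses alike. Agreement is
  required at binary assignments only, since the form of a clause is meaningful only there.\<close>

definition represents :: "nat \<Rightarrow> nat \<Rightarrow> 'v disj \<Rightarrow> (('v \<Rightarrow>\<^sub>0 int) \<times> int set) list \<Rightarrow> bool" where
  "represents d S D fs \<longleftrightarrow> length fs \<le> d \<and> (\<forall>p \<in> set fs. lin_norm (fst p) \<le> S) \<and>
    (\<forall>\<rho>. binary \<rho> \<longrightarrow> (sat_disj \<rho> D \<longleftrightarrow> (\<exists>p \<in> set fs. lin_val (fst p) \<rho> \<in> snd p)))"

lemma lin_norm_le_disj_size:
  assumes "finite E" "L \<in> E"
  shows "lin_norm (fst L) \<le> disj_size E"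
proof -
  have "lin_norm (fst L) \<le> lineq_size L" by (simp add: lineq_size_eq)
  also have "\<dots> \<le> disj_size E"
    unfolding disj_size_def using assms by (intro member_le_sum) auto
  finally show ?thesis .
qed

lemma same_form_represents:
  assumes "finite E" "E \<noteq> {}" "\<forall>L \<in> E. fst L = a"
  shows "lin_norm a \<le> disj_size E"
    and "sat_disj \<rho> E \<longleftrightarrow> lin_val a \<rho> \<in> snd ` E"
proof -
  show "lin_norm a \<le> disj_size E"
    using assms lin_norm_le_disj_size[of E] by (metis all_not_in_conv)
  show "sat_disj \<rho> E \<longleftrightarrow> lin_val a \<rho> \<in> snd ` E"
    using assms(3) by (force simp: sat_disj_def sat_lineq_iff)
qed

text \<open>Distinct literals give distinct equations, and the coefficient 1 makes each of them
  contribute at least 1 to the size, even when the free term is 0.\<close>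

lemma finite_clause_disj:
  assumes "finite (clause_disj I J)"
  shows "finite I" "finite J" "card I + card J \<le> disj_size (clause_disj I J)"
proof -
  have single_eq: "Poly_Mapping.single x (1 :: int) = Poly_Mapping.single y 1 \<longleftrightarrow> x = y" for x y :: 'a
    by (metis lookup_single_eq lookup_single_not_eq zero_neq_one)
  have inj: "inj_on (\<lambda>i. var_eq i b) K" for b and K :: "'a set"
    by (auto simp: inj_on_def var_eq_def single_eq)
  have fin: "finite ((\<lambda>i. var_eq i 1) ` I)" "finite ((\<lambda>j. var_eq j 0) ` J)"
    using assms by (auto simp: clause_disj_def)
  then show "finite I" "finite J"
    using inj by (auto dest: finite_imageD)
  have "card I + card J = card (clause_disj I J)"
    unfolding clause_disj_def using fin
    by (subst card_Un_disjoint) (auto simp: card_image[OF inj], auto simp: var_eq_def)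
  also have "\<dots> = (\<Sum>L \<in> clause_disj I J. 1)" by simp
  also have "\<dots> \<le> disj_size (clause_disj I J)"
    unfolding disj_size_def
    by (intro sum_mono) (auto simp: clause_disj_def var_eq_def lineq_size_def)
  finally show "card I + card J \<le> disj_size (clause_disj I J)" .
qed

text \<open>
  A clause is falsified by a binary assignment iff the sum of its literals vanishes; the negative
  literals contribute \<open>1 - x\<close>, hence the exceptional value \<open>- card J\<close>.
\<close>

lemma clause_represents:
  fixes I J :: "'v set"
  assumes "finite (clause_disj I J)"
  defines "a \<equiv> (\<Sum>i \<in> I. Poly_Mapping.single i 1) - (\<Sum>j \<in> J. Poly_Mapping.single j (1 :: int))"
  shows "lin_norm a \<le> disj_size (clause_disj I J)"
    and "binary \<rho> \<Longrightarrow> sat_disj \<rho> (clause_disj I J) \<longleftrightarrow> lin_val a \<rho> \<in> - {- int (card J)}"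
proof -
  note fin = finite_clause_disj[OF assms(1)]
  have "lin_norm a \<le> card I + card J"
    unfolding a_def
    using lin_norm_diff_le lin_norm_sum_single[OF fin(1)] lin_norm_sum_single[OF fin(2)]
    by (meson add_mono order_trans)
  then show "lin_norm a \<le> disj_size (clause_disj I J)" using fin(3) by simp
  assume \<rho>: "binary \<rho>"
  then have nonneg: "\<rho> x \<ge> 0" "1 - \<rho> x \<ge> 0" for x by (auto simp: binary_def dest: spec[of _ x])
  have "lin_val a \<rho> + int (card J) = (\<Sum>i \<in> I. \<rho> i) + (\<Sum>j \<in> J. 1 - \<rho> j)"
    by (simp add: a_def lin_val_diff lin_val_sum_single fin sum_subtractf)
  moreover have "(\<Sum>i \<in> I. \<rho> i) + (\<Sum>j \<in> J. 1 - \<rho> j) = 0 \<longleftrightarrow>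
      (\<Sum>i \<in> I. \<rho> i) = 0 \<and> (\<Sum>j \<in> J. 1 - \<rho> j) = 0"
    using nonneg by (intro add_nonneg_eq_0_iff sum_nonneg) auto
  moreover have "(\<Sum>i \<in> I. \<rho> i) = 0 \<longleftrightarrow> (\<forall>i \<in> I. \<rho> i = 0)"
    using fin nonneg by (intro sum_nonneg_eq_0_iff) auto
  moreover have "(\<Sum>j \<in> J. 1 - \<rho> j) = 0 \<longleftrightarrow> (\<forall>j \<in> J. 1 - \<rho> j = 0)"
    using fin nonneg by (intro sum_nonneg_eq_0_iff) auto
  moreover have "sat_disj \<rho> (clause_disj I J) \<longleftrightarrow>
      \<not> ((\<forall>i \<in> I. \<rho> i = 0) \<and> (\<forall>j \<in> J. 1 - \<rho> j = 0))"
  proof -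
    have "sat_disj \<rho> (clause_disj I J) \<longleftrightarrow> (\<exists>i \<in> I. \<rho> i = 1) \<or> (\<exists>j \<in> J. \<rho> j = 0)"
      unfolding sat_disj_def clause_disj_def bex_Un bex_simps(7)
      by (simp add: sat_lineq_iff var_eq_def)
    moreover have "\<rho> x = 1 \<longleftrightarrow> \<rho> x \<noteq> 0" for x
      using \<rho> by (metis binary_def zero_neq_one)
    ultimately show ?thesis by auto
  qed
  ultimately show "sat_disj \<rho> (clause_disj I J) \<longleftrightarrow> lin_val a \<rho> \<in> - {- int (card J)}"
    by auto
qed

text \<open>Each block of the partition yields one form, whose norm is bounded by the size of the
  block. The clause on the empty line leaves the last line of a refutation with a single value
  vector, so that one separator handles all solutions.\<close>

lemma R0lin_line_represents:
  assumes "finite D" "R0lin_line c d D" "disj_size D \<le> S"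
  shows "\<exists>fs. represents d S D fs \<and> (D = {} \<longrightarrow> fs = [])"
proof -
  obtain P where P: "partition_on D P" "card P \<le> d"
    "\<And>E. E \<in> P \<Longrightarrow> (\<exists>a. \<forall>L \<in> E. fst L = a) \<or> (\<exists>I J. E = clause_disj I J)"
    using assms(2) unfolding R0lin_line_def by (elim conjE exE) (rule that, auto)
  have "\<exists>p. lin_norm (fst p) \<le> S \<and>
      (\<forall>\<rho>. binary \<rho> \<longrightarrow> (sat_disj \<rho> E \<longleftrightarrow> lin_val (fst p) \<rho> \<in> snd p))" if E: "E \<in> P" for E
  proof -
    have sub: "E \<subseteq> D" "E \<noteq> {}" using E P(1) by (auto simp: partition_on_def)
    then have fin: "finite E" using assms(1) finite_subset by blast
    have "disj_size E \<le> disj_size D"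
      unfolding disj_size_def using sub assms(1) by (intro sum_mono2) auto
    then have le: "disj_size E \<le> S" using assms(3) by simp
    show ?thesis
      using P(3)[OF E]
    proof (elim disjE exE)
      fix a
      assume "\<forall>L \<in> E. fst L = a"
      from same_form_represents[OF fin sub(2) this] show ?thesis
        using le by (intro exI[of _ "(a, snd ` E)"]) auto
    next
      fix I J
      assume "E = clause_disj I J"
      then show ?thesis
        using clause_represents[of I J] fin order_trans[OF _ le]
        by (intro exI[of _ "((\<Sum>i \<in> I. Poly_Mapping.single i 1) -
          (\<Sum>j \<in> J. Poly_Mapping.single j 1), - {- int (card J)})"]) (simp del: Compl_iff)
    qed
  qed
  then obtain h where h: "\<And>E. E \<in> P \<Longrightarrow> lin_norm (fst (h E)) \<le> S"
    "\<And>E \<rho>. E \<in> P \<Longrightarrow> binary \<rho> \<Longrightarrow> sat_disj \<rho> E \<longleftrightarrow> lin_val (fst (h E)) \<rho> \<in> snd (h E)"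
    by metis
  have "finite P" using P(1) assms(1) by (rule finite_elements[rotated])
  then obtain Es where Es: "set Es = P" "distinct Es" using finite_distinct_list by blast
  have union: "\<Union>P = D" using P(1) by (simp add: partition_on_def)
  have "sat_disj \<rho> D \<longleftrightarrow> (\<exists>E \<in> P. sat_disj \<rho> E)" for \<rho>
    unfolding sat_disj_def union[symmetric] by blast
  then have "represents d S D (map h Es)"
    using h P(2) Es by (auto simp: represents_def distinct_card[symmetric])
  moreover have "map h Es = []" if "D = {}"
    using that Es P(1) partition_on_empty by auto
  ultimately show ?thesis by blast
qed

section \<open>Value vectors of the forms of a line\<close>

definition form_vals :: "(('v \<Rightarrow>\<^sub>0 int) \<times> int set) list \<Rightarrow> ('v \<Rightarrow> int) \<Rightarrow> int list" where
  "form_vals fs \<rho> = map (\<lambda>p. lin_val (fst p) \<rho>) fs"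

definition falsified :: "(('v \<Rightarrow>\<^sub>0 int) \<times> int set) list \<Rightarrow> int list \<Rightarrow> int list \<Rightarrow> bool" where
  "falsified fs s t \<longleftrightarrow> (\<forall>i < length fs. s ! i + t ! i \<notin> snd (fs ! i))"

text \<open>Forms are additive in the assignment, so each value at the joint assignment is the sum
  of the two contributions. Only the sum has to be binary.\<close>

lemma falsified_form_vals:
  assumes "represents d S D fs" "binary (\<lambda>x. \<rho> x + \<sigma> x)"
  shows "falsified fs (form_vals fs \<rho>) (form_vals fs \<sigma>) \<longleftrightarrow> \<not> sat_disj (\<lambda>x. \<rho> x + \<sigma> x) D"
proof -
  have "sat_disj (\<lambda>x. \<rho> x + \<sigma> x) D \<longleftrightarrow>
      (\<exists>p \<in> set fs. lin_val (fst p) \<rho> + lin_val (fst p) \<sigma> \<in> snd p)"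
    using assms by (auto simp: represents_def lin_val_assign_add)
  also have "\<dots> \<longleftrightarrow> \<not> falsified fs (form_vals fs \<rho>) (form_vals fs \<sigma>)"
    by (auto simp: falsified_def form_vals_def Bex_set_list_ex list_ex_length)
  finally show ?thesis by blast
qed

definition types :: "nat \<Rightarrow> nat \<Rightarrow> int list set" where
  "types d S = {s. set s \<subseteq> {- int S..int S} \<and> length s \<le> d}"

lemma finite_types [simp]: "finite (types d S)"
  unfolding types_def by (rule finite_lists_length_le) simp

lemma card_types: "card (types d S) = (\<Sum>i \<le> d. (2 * S + 1) ^ i)"
proof -
  have "card (types d S) = (\<Sum>i \<le> d. card {- int S..int S} ^ i)"
    unfolding types_def by (rule card_lists_length_le) simp
  moreover have "card {- int S..int S} = 2 * S + 1" by simp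
  ultimately show ?thesis by simp
qed

lemma form_vals_types:
  assumes "represents d S D fs" "binary \<rho>"
  shows "form_vals fs \<rho> \<in> types d S"
proof -
  have "\<bar>lin_val (fst p) \<rho>\<bar> \<le> int S" if "p \<in> set fs" for p
  proof -
    have "int (lin_norm (fst p)) \<le> int S" using assms(1) that by (auto simp: represents_def)
    then show ?thesis using abs_lin_val_le[OF assms(2), of "fst p"] by linarith
  qed
  then show ?thesis using assms(1)
    by (force simp: types_def form_vals_def represents_def)
qed

text \<open>The vector \<open>t\<close> is fixed and built into the circuit; only the assignment to
  \<open>ps\<close> is read. This is the separator at the initial lines from
  \<open>B\<close>.\<close>

lemma adds_falsified:
  assumes "distinct ps" "represents d S D fs"
  shows "adds (length ps) {} {\<lambda>w. falsified fs (form_vals fs (assign ps w)) t}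
    (d * ((S + 1) * (12 * S + 8) + (4 * S + 3) + 1) + 1)"
proof -
  let ?m = "(S + 1) * (12 * S + 8) + (4 * S + 3)"
  define f where "f i w \<longleftrightarrow> lin_val (fst (fs ! i)) (assign ps w) + t ! i \<notin> snd (fs ! i)" for i w
  have f: "adds (length ps) {} {f i} ?m" if "i < length fs" for i
  proof -
    let ?a = "fst (fs ! i)"
    let ?H = "range (\<lambda>s w. lin_val ?a (assign ps w) = s)"
    \<comment> \<open>The satisfying set may be infinite, but the form takes values between
      \<open>- S\<close> and \<open>S\<close> only, so it suffices to exclude these finitely
      many.\<close>
    let ?R = "{s \<in> {- int S..int S}. s + t ! i \<in> snd (fs ! i)}"
    have norm: "lin_norm ?a \<le> S" using assms(2) that by (auto simp: represents_def)
    have "lin_val ?a (assign ps w) \<in> {- int S..int S}" for w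
      using abs_lin_val_le[of "assign ps w" ?a] norm by auto
    then have eq: "f i = (\<lambda>w. \<forall>s \<in> ?R. \<not> lin_val ?a (assign ps w) = s)"
      by (auto simp: f_def fun_eq_iff)
    \<comment> \<open>A negation and a conjunction for each of at most \<open>2 * S + 1\<close>
      values, and one constant: this is the summand \<open>4 * S + 3\<close>.\<close>
    have "adds (length ps) ({} \<union> ?H) {f i} (card ?R * ((0 + 1) + 1) + 1)"
      unfolding eq by (intro adds_ball adds_not adds_subset finite_Collect_conjI) auto
    with adds_lin_val[OF assms(1)] have
      "adds (length ps) {} {f i} ((lin_norm ?a + 1) * (12 * lin_norm ?a + 8) +
        (card ?R * ((0 + 1) + 1) + 1))"
      by (rule adds_cut)
    moreover have "card ?R \<le> card {- int S..int S}" by (intro card_mono) auto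
    then have "card ?R \<le> 2 * S + 1" by simp
    moreover have "(lin_norm ?a + 1) * (12 * lin_norm ?a + 8) \<le> (S + 1) * (12 * S + 8)"
      using norm by (intro mult_le_mono) auto
    ultimately show ?thesis by (elim adds_mono) auto
  qed
  have adds: "adds (length ps) {} {\<lambda>w. \<forall>i \<in> {..<length fs}. f i w}
      (card {..<length fs} * (?m + 1) + 1)"
    by (intro adds_ball f) auto
  have eq: "(\<lambda>w. falsified fs (form_vals fs (assign ps w)) t) =
      (\<lambda>w. \<forall>i \<in> {..<length fs}. f i w)"
    by (auto simp: fun_eq_iff falsified_def form_vals_def f_def)
  have le: "card {..<length fs} * (?m + 1) + 1 \<le> d * (?m + 1) + 1"
    using assms(2) by (simp add: represents_def del: mult_Suc_right)
  show ?thesis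
    unfolding eq by (rule adds_mono[OF adds _ _ le]) simp_all
qed

section \<open>Interpolation\<close>

text \<open>The lists are disjoint and the value off a list is 0, so at most one summand is
  non-zero. Concatenation thus becomes addition, which linear forms respect.\<close>

lemma assign_append:
  assumes "length u = length ps" "distinct (ps @ ys)"
  shows "assign (ps @ ys) (u @ w) = (\<lambda>x. assign ps u x + assign ys w x)"
proof
  fix x
  show "assign (ps @ ys) (u @ w) x = assign ps u x + assign ys w x"
  proof (cases "x \<in> set ps")
    case True
    then have "map_of (zip ps u) x \<noteq> None" using assms(1) by simp
    moreover have "map_of (zip ys w) x = None"
      using True assms(2) by (auto simp: map_of_eq_None_iff dest: set_zip_leftD)
    ultimately show ?thesis
      using assms(1) by (auto simp: assign_def map_add_def split: option.splits)
  next
    case False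
    then have "map_of (zip ps u) x = None" using assms(1) by simp
    then show ?thesis
      using assms(1) by (simp add: assign_def map_add_def del: map_of_zip_is_None)
  qed
qed

lemma assign_outside: "x \<notin> set xs \<Longrightarrow> assign xs bs x = 0"
  by (auto simp: assign_def dest: map_of_SomeD set_zip_leftD)

lemma sat_disj_cong:
  assumes "disj_over X D" "\<And>x. x \<in> X \<Longrightarrow> \<rho> x = \<sigma> x"
  shows "sat_disj \<rho> D \<longleftrightarrow> sat_disj \<sigma> D"
proof -
  have "sat_lineq \<rho> L \<longleftrightarrow> sat_lineq \<sigma> L" if "L \<in> D" for L
  proof -
    have "Poly_Mapping.keys (fst L) \<subseteq> X" using assms(1) that by (fastforce simp: disj_over_def)
    then have "(\<Sum>x \<in> Poly_Mapping.keys (fst L). Poly_Mapping.lookup (fst L) x * \<rho> x) =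
        (\<Sum>x \<in> Poly_Mapping.keys (fst L). Poly_Mapping.lookup (fst L) x * \<sigma> x)"
      using assms(2) by (intro sum.cong) auto
    then show ?thesis by (simp add: sat_lineq_def)
  qed
  then show ?thesis by (auto simp: sat_disj_def)
qed

text \<open>Rules with one premise are read as having two equal premises, so that a single kind of
  inference remains.\<close>

lemma Rlin_step_sound:
  assumes "Rlin_step X K Ds D"
  shows "D \<in> K \<or> (\<forall>\<rho>. binary \<rho> \<longrightarrow> sat_disj \<rho> D) \<or>
    (\<exists>D1 \<in> Ds. \<exists>D2 \<in> Ds. \<forall>\<rho>. sat_disj \<rho> D1 \<longrightarrow> sat_disj \<rho> D2 \<longrightarrow> sat_disj \<rho> D)"
  using assms
proof cases
  case (boolean x)
  then show ?thesis by (auto simp: binary_def sat_disj_def sat_lineq_iff var_eq_def)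
next
  case (resolution_add L1 A L2 B)
  have "sat_disj \<rho> D" if "sat_disj \<rho> (insert L1 A)" "sat_disj \<rho> (insert L2 B)" for \<rho>
    using that unfolding resolution_add(1) by (auto simp: sat_disj_def sat_lineq_iff lin_val_add)
  then show ?thesis using resolution_add(2,3) by blast
next
  case (resolution_sub L1 A L2 B)
  have "sat_disj \<rho> D" if "sat_disj \<rho> (insert L1 A)" "sat_disj \<rho> (insert L2 B)" for \<rho>
    using that unfolding resolution_sub(1) by (auto simp: sat_disj_def sat_lineq_iff lin_val_diff)
  then show ?thesis using resolution_sub(2,3) by blast
next
  case (weakening A L)
  have "sat_disj \<rho> D" if "sat_disj \<rho> A" for \<rho>
    using that unfolding weakening(1) by (auto simp: sat_disj_def)
  then show ?thesis using weakening(2) by blast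
next
  case (simplification k)
  have "sat_disj \<rho> D" if "sat_disj \<rho> (insert (0, k) D)" for \<rho>
    using that simplification(2) by (auto simp: sat_disj_def sat_lineq_iff)
  then show ?thesis using simplification(1) by blast
qed simp

text \<open>A common bound for both kinds of lines: the first summand pays for an inference, the
  second for an initial line from \<open>B\<close>.\<close>

definition separator_cost :: "nat \<Rightarrow> nat \<Rightarrow> nat" where
  "separator_cost d S = card (types d S) * card (types d S) * (card (types d S) * card (types d S) + 2) +
    d * ((S + 1) * (12 * S + 8) + (4 * S + 3) + 1) + 1"

section \<open>Solutions of the two players and their joint assignment\<close>

locale interpolation =
  fixes ps qs rs :: "'v list" and A B :: "'v disj set"
  assumes distinct: "distinct (ps @ qs @ rs)"
    and over_A: "\<And>D. D \<in> A \<Longrightarrow> disj_over (set ps \<union> set qs) D"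
    and over_B: "\<And>D. D \<in> B \<Longrightarrow> disj_over (set ps \<union> set rs) D"
begin

definition alice :: "bool list \<times> bool list \<Rightarrow> 'v \<Rightarrow> int" where
  "alice p = assign (ps @ qs) (fst p @ snd p)"

definition bob :: "bool list \<times> bool list \<Rightarrow> 'v \<Rightarrow> int" where
  "bob q = assign rs (snd q)"

text \<open>
  Both players judge a line at Alice's values of \<open>ps\<close> and \<open>qs\<close> and Bob's values of \<open>rs\<close>; Bob's
  values of \<open>ps\<close> matter only at the initial lines from \<open>B\<close>.
\<close>

abbreviation joint :: "bool list \<times> bool list \<Rightarrow> bool list \<times> bool list \<Rightarrow> 'v \<Rightarrow> int" where
  "joint p q \<equiv> \<lambda>x. alice p x + bob q x"

text \<open>Solutions keep the values of \<open>qs\<close>, because Alice's value vectors depend on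
  them and not only on the vector to be separated.\<close>

definition sols_A :: "(bool list \<times> bool list) set" where
  "sols_A = {p. length (fst p) = length ps \<and> length (snd p) = length qs \<and>
    (\<forall>D \<in> A. sat_disj (assign (ps @ qs) (fst p @ snd p)) D)}"

definition sols_B :: "(bool list \<times> bool list) set" where
  "sols_B = {q. length (fst q) = length ps \<and> length (snd q) = length rs \<and>
    (\<forall>D \<in> B. sat_disj (assign (ps @ rs) (fst q @ snd q)) D)}"

lemma extendable_A: "extendable ps qs A = fst ` sols_A"
  unfolding extendable_def sols_A_def image_def by auto

lemma extendable_B: "extendable ps rs B = fst ` sols_B"
  unfolding extendable_def sols_B_def image_def by auto

lemma binary_alice [simp]: "binary (alice p)" and binary_bob [simp]: "binary (bob q)"
  by (simp_all add: alice_def bob_def)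

lemma binary_add_assign:
  assumes "binary \<rho>" "\<And>x. x \<in> set rs \<Longrightarrow> \<rho> x = 0"
  shows "binary (\<lambda>x. \<rho> x + assign rs z x)"
  unfolding binary_def
proof
  fix x
  show "\<rho> x + assign rs z x = 0 \<or> \<rho> x + assign rs z x = 1"
    using assms binary_assign[of rs z] assign_outside[of x rs z]
    by (cases "x \<in> set rs") (auto simp: binary_def)
qed

lemma binary_joint: "binary (joint p q)"
  unfolding bob_def
  by (rule binary_add_assign) (use distinct in \<open>auto simp: alice_def intro!: assign_outside\<close>)

lemma binary_assign_bob: "binary (\<lambda>x. assign ps u x + bob q x)"
  unfolding bob_def
  by (rule binary_add_assign) (use distinct in \<open>auto intro!: assign_outside\<close>)

lemma joint_sat_A:
  assumes "p \<in> sols_A" "D \<in> A"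
  shows "sat_disj (joint p q) D"
proof -
  have "sat_disj (joint p q) D \<longleftrightarrow> sat_disj (alice p) D"
    using distinct
    by (intro sat_disj_cong[OF over_A[OF assms(2)]]) (auto simp: bob_def intro!: assign_outside)
  then show ?thesis using assms by (auto simp: alice_def sols_A_def)
qed

text \<open>Lines from \<open>B\<close> do not mention \<open>qs\<close>, so at such a line Alice's
  extension drops out and her input vector alone decides, given Bob's values of
  \<open>rs\<close>.\<close>

lemma joint_eq_B:
  assumes "p \<in> sols_A" "D \<in> B"
  shows "sat_disj (joint p q) D \<longleftrightarrow> sat_disj (\<lambda>x. assign ps (fst p) x + bob q x) D"
proof (rule sat_disj_cong[OF over_B[OF assms(2)]])
  fix x
  assume "x \<in> set ps \<union> set rs"
  then have "x \<notin> set qs" using distinct by auto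
  moreover have "alice p x = assign ps (fst p) x + assign qs (snd p) x"
    unfolding alice_def using assms(1) distinct by (subst assign_append) (auto simp: sols_A_def)
  ultimately show "joint p q x = assign ps (fst p) x + bob q x"
    by (simp add: assign_outside)
qed

lemma sat_B:
  assumes "q \<in> sols_B" "D \<in> B"
  shows "sat_disj (\<lambda>x. assign ps (fst q) x + bob q x) D"
proof -
  have "assign (ps @ rs) (fst q @ snd q) = (\<lambda>x. assign ps (fst q) x + bob q x)"
    unfolding bob_def using assms(1) distinct by (intro assign_append) (auto simp: sols_B_def)
  then show ?thesis using assms by (auto simp: sols_B_def)
qed

section \<open>Separators for the false lines of a proof\<close>

context
  fixes d S :: nat and forms :: "'v disj \<Rightarrow> (('v \<Rightarrow>\<^sub>0 int) \<times> int set) list"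
begin

definition side_A :: "'v disj \<Rightarrow> int list \<Rightarrow> (bool list \<times> bool list) set" where
  "side_A D s = {p \<in> sols_A. form_vals (forms D) (alice p) = s}"

definition side_B :: "'v disj \<Rightarrow> int list \<Rightarrow> (bool list \<times> bool list) set" where
  "side_B D t = {q \<in> sols_B. form_vals (forms D) (bob q) = t}"

definition separator :: "(bool list \<Rightarrow> bool) \<Rightarrow> 'v disj \<Rightarrow> int list \<Rightarrow> int list \<Rightarrow> bool" where
  "separator f D s t \<longleftrightarrow> (\<forall>p \<in> side_A D s. f (fst p)) \<and> (\<forall>q \<in> side_B D t. \<not> f (fst q))"

definition separated :: "(bool list \<Rightarrow> bool) set \<Rightarrow> 'v disj \<Rightarrow> bool" where
  "separated F D \<longleftrightarrow> (\<forall>s \<in> types d S. \<forall>t \<in> types d S.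
    falsified (forms D) s t \<longrightarrow> (\<exists>f \<in> F. separator f D s t))"

text \<open>The test is whether \<open>D\<close> fails at the given vector for \<open>ps\<close>
  together with Bob's contribution \<open>t\<close>. It accepts Alice's side because
  \<open>D\<close> does not see \<open>qs\<close>, and rejects Bob's side because his own vector
  satisfies \<open>D\<close>.\<close>

lemma adds_separator_initial:
  assumes rep: "represents d S D (forms D)" and D: "D \<in> B"
    and fals: "falsified (forms D) s t" and p0: "p0 \<in> side_A D s" and q0: "q0 \<in> side_B D t"
  shows "\<exists>f. adds (length ps) {} {f} (separator_cost d S) \<and> separator f D s t"
proof (intro exI conjI)
  let ?f = "\<lambda>w. falsified (forms D) (form_vals (forms D) (assign ps w)) t"
  show "adds (length ps) {} {?f} (separator_cost d S)"
    by (rule adds_mono[OF adds_falsified[OF _ rep]])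
      (use distinct in \<open>auto simp: separator_cost_def\<close>)
  \<comment> \<open>As \<open>q\<close> has the value vector \<open>t\<close>, falsity at
    \<open>t\<close> is falsity at the assignment formed from \<open>w\<close> and Bob's values of
    \<open>rs\<close>.\<close>
  have f: "?f w \<longleftrightarrow> \<not> sat_disj (\<lambda>x. assign ps w x + bob q x) D" if "q \<in> side_B D t" for w q
    using that falsified_form_vals[OF rep binary_assign_bob, of w q] by (auto simp: side_B_def)
  show "separator ?f D s t"
    unfolding separator_def
  proof (intro conjI ballI)
    fix p
    assume p: "p \<in> side_A D s"
    then have "\<not> sat_disj (joint p q0) D"
      using fals q0 falsified_form_vals[OF rep binary_joint, of p q0]
      by (auto simp: side_A_def side_B_def)
    then show "?f (fst p)"
      using joint_eq_B[of p D q0] p D f[OF q0] by (auto simp: side_A_def)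
  next
    fix q
    assume q: "q \<in> side_B D t"
    then show "\<not> ?f (fst q)" using sat_B[of q D] D f[OF q] by (auto simp: side_B_def)
  qed
qed

text \<open>Which premise is false depends on both players together, so the class of a player
  records the value vectors for both premises. Hence \<open>?T\<close> is a product, and the cost is
  quadratic in its cardinality.\<close>

lemma adds_separator_inference:
  assumes rep: "represents d S D (forms D)" "represents d S D1 (forms D1)"
      "represents d S D2 (forms D2)"
    and sep: "separated F D1" "separated F D2"
    and sound: "\<And>\<rho>. sat_disj \<rho> D1 \<Longrightarrow> sat_disj \<rho> D2 \<Longrightarrow> sat_disj \<rho> D"
    and fals: "falsified (forms D) s t"
  shows "\<exists>f. adds (length ps) F {f} (separator_cost d S) \<and> separator f D s t"
proof -
  let ?T = "types d S \<times> types d S"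
  define \<alpha> where
    "\<alpha> p = (form_vals (forms D1) (alice p), form_vals (forms D2) (alice p))" for p
  define \<beta> where "\<beta> q = (form_vals (forms D1) (bob q), form_vals (forms D2) (bob q))" for q
  have sep': "\<exists>g \<in> F. (\<forall>p' \<in> side_A D s. \<alpha> p' = \<alpha> p \<longrightarrow> g (fst p')) \<and>
      (\<forall>q' \<in> side_B D t. \<beta> q' = \<beta> q \<longrightarrow> \<not> g (fst q'))"
    if p: "p \<in> side_A D s" and q: "q \<in> side_B D t" for p q
  proof -
    have "\<not> sat_disj (joint p q) D"
      using p q fals falsified_form_vals[OF rep(1) binary_joint, of p q]
      by (auto simp: side_A_def side_B_def)
    then have "\<not> sat_disj (joint p q) D1 \<or> \<not> sat_disj (joint p q) D2" using sound by blast
    then obtain D' where D': "D' \<in> {D1, D2}" "\<not> sat_disj (joint p q) D'" by blast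
    let ?s = "form_vals (forms D') (alice p)"
    let ?t = "form_vals (forms D') (bob q)"
    have rep': "represents d S D' (forms D')" "separated F D'" using D'(1) rep sep by auto
    then have "falsified (forms D') ?s ?t"
      using D'(2) falsified_form_vals[OF rep'(1) binary_joint, of p q] by simp
    moreover have "?s \<in> types d S" "?t \<in> types d S"
      using form_vals_types[OF rep'(1)] by auto
    \<comment> \<open>The false premise was found for one pair of solutions, but its value vectors
      are components of \<open>\<alpha> p\<close> and \<open>\<beta> q\<close>, so its separator
      serves both whole classes.\<close>
    ultimately obtain g where "g \<in> F" "separator g D' ?s ?t"
      using rep'(2) unfolding separated_def by blast
    then show ?thesis
      using D'(1) by (intro bexI[of _ g]) (auto simp: separator_def side_A_def side_B_def \<alpha>_def \<beta>_def)
  qed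
  have image: "\<alpha> ` side_A D s \<subseteq> ?T" "\<beta> ` side_B D t \<subseteq> ?T"
    using form_vals_types[OF rep(2)] form_vals_types[OF rep(3)] by (auto simp: \<alpha>_def \<beta>_def)
  obtain f where f: "adds (length ps) F {f} (card ?T * (card ?T + 2) + 1)"
    "\<And>p. p \<in> side_A D s \<Longrightarrow> f (fst p)" "\<And>q. q \<in> side_B D t \<Longrightarrow> \<not> f (fst q)"
    using adds_separator[OF _ _ image sep', where n = "length ps"] by (metis finite_SigmaI finite_types)
  have "adds (length ps) F {f} (separator_cost d S)"
    by (rule adds_mono[OF f(1)]) (auto simp: separator_cost_def card_cartesian_product)
  then show ?thesis using f(2,3) by (auto simp: separator_def)
qed

lemma adds_separator_step:
  assumes rep: "\<And>D'. D' \<in> insert D Ds \<Longrightarrow> represents d S D' (forms D')"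
    and sep: "\<And>D'. D' \<in> Ds \<Longrightarrow> separated F D'"
    and step: "Rlin_step X (A \<union> B) Ds D"
    and fals: "falsified (forms D) s t"
  shows "\<exists>f. adds (length ps) F {f} (separator_cost d S) \<and> separator f D s t"
proof (cases "side_A D s = {} \<or> side_B D t = {}")
  case True
  \<comment> \<open>If one side is empty, a constant separates.\<close>
  have "adds (length ps) F {\<lambda>_. b} (separator_cost d S)" for b
    by (rule adds_mono[OF adds_const]) (auto simp: separator_cost_def)
  then show ?thesis using True unfolding separator_def by blast
next
  case False
  then obtain p0 q0 where pq: "p0 \<in> side_A D s" "q0 \<in> side_B D t" by blast
  \<comment> \<open>Falsity at an actual joint assignment rules out Boolean axioms and the initial
    lines from \<open>A\<close>, which hold at Alice's solution.\<close>
  have "\<not> sat_disj (joint p0 q0) D"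
    using fals pq rep falsified_form_vals[OF _ binary_joint, of d S D "forms D" p0 q0]
    by (auto simp: side_A_def side_B_def)
  then consider "D \<in> B" | D1 D2 where "D1 \<in> Ds" "D2 \<in> Ds"
      "\<And>\<rho>. sat_disj \<rho> D1 \<Longrightarrow> sat_disj \<rho> D2 \<Longrightarrow> sat_disj \<rho> D"
    using Rlin_step_sound[OF step] binary_joint[of p0 q0] joint_sat_A[of p0 D q0] pq(1)
    unfolding side_A_def by blast
  then show ?thesis
  proof cases
    case 1
    then obtain f where "adds (length ps) {} {f} (separator_cost d S)" "separator f D s t"
      using adds_separator_initial[OF _ _ fals pq] rep by blast
    then show ?thesis by (intro exI[of _ f] conjI, elim adds_mono) auto
  next
    case 2
    from rep 2(1,2) have "represents d S D (forms D)" "represents d S D1 (forms D1)"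
      "represents d S D2 (forms D2)" by blast+
    then show ?thesis using sep[OF 2(1)] sep[OF 2(2)] 2(3) fals
      by (rule adds_separator_inference)
  qed
qed

text \<open>Lines are handled in proof order, so at each inference the separators of the premises
  are already computed. A repeated line costs nothing, so the bound counts distinct lines.\<close>

lemma realizable_separators:
  assumes rep: "\<And>D. D \<in> set \<pi> \<Longrightarrow> represents d S D (forms D)"
    and step: "\<And>i. i < length \<pi> \<Longrightarrow> Rlin_step X (A \<union> B) (set (take i \<pi>)) (\<pi> ! i)"
    and "k \<le> length \<pi>"
  shows "\<exists>F. realizable (length ps) F
      (card (set (take k \<pi>)) * (card (types d S) * card (types d S) * separator_cost d S)) \<and>
    (\<forall>D \<in> set (take k \<pi>). separated F D)"
  using \<open>k \<le> length \<pi>\<close>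
proof (induction k)
  case 0
  then show ?case using realizable_empty by auto
next
  case (Suc k)
  let ?D = "\<pi> ! k"
  let ?m = "card (types d S) * card (types d S) * separator_cost d S"
  let ?T = "types d S \<times> types d S"
  have k: "k < length \<pi>" using Suc.prems by simp
  have set_Suc: "set (take (Suc k) \<pi>) = insert ?D (set (take k \<pi>))"
    using k by (simp add: take_Suc_conv_app_nth)
  obtain F where F: "realizable (length ps) F (card (set (take k \<pi>)) * ?m)"
    "\<And>D. D \<in> set (take k \<pi>) \<Longrightarrow> separated F D"
    using Suc k by auto
  show ?case
  proof (cases "?D \<in> set (take k \<pi>)")
    case True
    then show ?thesis using F by (auto simp: set_Suc insert_absorb)
  next
    case False
    have "\<exists>f. adds (length ps) F {f} (separator_cost d S) \<and>
        (falsified (forms ?D) (fst x) (snd x) \<longrightarrow> separator f ?D (fst x) (snd x))" for x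
    proof (cases "falsified (forms ?D) (fst x) (snd x)")
      case True
      have "represents d S D' (forms D')" if "D' \<in> insert ?D (set (take k \<pi>))" for D'
        using that k by (intro rep) (auto dest: in_set_takeD)
      then show ?thesis
        using adds_separator_step[OF _ F(2) step[OF k] True] by blast
    next
      case False
      \<comment> \<open>A dummy for pairs at which the line is not falsified; it makes
        \<open>g\<close> total.\<close>
      have "adds (length ps) F {\<lambda>_. True} (separator_cost d S)"
        by (rule adds_mono[OF adds_const]) (auto simp: separator_cost_def)
      then show ?thesis using False by blast
    qed
    then obtain g where g: "\<And>x. adds (length ps) F {g x} (separator_cost d S)"
      "\<And>x. falsified (forms ?D) (fst x) (snd x) \<Longrightarrow> separator (g x) ?D (fst x) (snd x)"
      by metis
    have "adds (length ps) F (g ` ?T) (card ?T * separator_cost d S)"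
      by (intro adds_image g) auto
    then have "realizable (length ps) (F \<union> g ` ?T)
        (card (set (take k \<pi>)) * ?m + card ?T * separator_cost d S)"
      using F(1) by (intro addsD[of _ F]) auto
    moreover have "card (set (take k \<pi>)) * ?m + card ?T * separator_cost d S =
        card (set (take (Suc k) \<pi>)) * ?m"
      using False by (simp add: set_Suc card_cartesian_product)
    moreover have "separated (F \<union> g ` ?T) D" if "D \<in> set (take (Suc k) \<pi>)" for D
    proof (cases "D = ?D")
      case True
      have "\<exists>f \<in> F \<union> g ` ?T. separator f D s t"
        if "s \<in> types d S" "t \<in> types d S" "falsified (forms D) s t" for s t
        using that g(2)[of "(s, t)"] True by (intro bexI[of _ "g (s, t)"]) auto
      then show ?thesis unfolding separated_def by blast
    next
      case False
      then have "separated F D" using that F(2) set_Suc by auto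
      then show ?thesis unfolding separated_def by blast
    qed
    ultimately show ?thesis by auto
  qed
qed

end

end

section \<open>Number of distinct lines and the final circuit\<close>

text \<open>
  The equation \<open>0 = 0\<close> and the empty disjunction have size 0, so that the length of a proof is not
  bounded by its size. The number of distinct lines is.
\<close>

lemma card_set_le_proof_size:
  assumes "\<And>D. D \<in> set \<pi> \<Longrightarrow> finite D"
  shows "card (set \<pi>) \<le> proof_size \<pi> + 2"
proof -
  have zero: "D = {} \<or> D = {0}" if "D \<in> set \<pi>" "disj_size D = 0" for D
  proof -
    have "L = 0" if "L \<in> D" for L
    proof -
      have "lineq_size L = 0"
        using that \<open>disj_size D = 0\<close> assms[OF \<open>D \<in> set \<pi>\<close>] by (simp add: disj_size_def)
      then have "snd L = 0" "\<forall>x \<in> Poly_Mapping.keys (fst L). Poly_Mapping.lookup (fst L) x = 0"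
        by (auto simp: lineq_size_def)
      then have "Poly_Mapping.keys (fst L) = {}" using in_keys_iff by fast
      then show ?thesis using \<open>snd L = 0\<close> by (simp add: prod_eq_iff)
    qed
    then have "D \<subseteq> {0}" by blast
    then show ?thesis by (rule subset_singletonD)
  qed
  have "(\<Sum>D \<in> set \<pi>. disj_size D) \<le> proof_size \<pi>"
    unfolding proof_size_def by (induction \<pi>) (auto simp: sum.insert_if)
  moreover have "card {D \<in> set \<pi>. disj_size D \<noteq> 0} \<le> (\<Sum>D \<in> set \<pi>. disj_size D)"
  proof -
    have "card {D \<in> set \<pi>. disj_size D \<noteq> 0} = (\<Sum>D \<in> {D \<in> set \<pi>. disj_size D \<noteq> 0}. 1)" by simp
    also have "\<dots> \<le> (\<Sum>D \<in> {D \<in> set \<pi>. disj_size D \<noteq> 0}. disj_size D)"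
      by (intro sum_mono) auto
    also have "\<dots> \<le> (\<Sum>D \<in> set \<pi>. disj_size D)" by (intro sum_mono2) auto
    finally show ?thesis .
  qed
  moreover have "card (set \<pi>) \<le> card ({D \<in> set \<pi>. disj_size D \<noteq> 0} \<union> {{}, {0}})"
    using zero by (intro card_mono) auto
  moreover have "card ({D \<in> set \<pi>. disj_size D \<noteq> 0} \<union> {{}, {0}}) \<le>
      card {D \<in> set \<pi>. disj_size D \<noteq> 0} + card {{}, {0 :: 'a lineq}}"
    by (rule card_Un_le)
  ultimately show ?thesis by simp
qed

lemma disj_size_le_proof_size: "D \<in> set \<pi> \<Longrightarrow> disj_size D \<le> proof_size \<pi>"
  unfolding proof_size_def by (intro member_le_sum_list) auto

lemma (in interpolation) interpolant_circuit:
  assumes ref: "R0lin_refutation c d X (A \<union> B) \<pi>"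
  defines "S \<equiv> proof_size \<pi>"
  obtains C where "circuit_over (length ps) C"
    "circuit_size C \<le> (S + 2) * (card (types d S) * card (types d S) * separator_cost d S)"
    "separates C (extendable ps qs A) (extendable ps rs B)"
proof -
  have \<pi>: "\<pi> \<noteq> []" "last \<pi> = {}" "\<And>D. D \<in> set \<pi> \<Longrightarrow> finite D"
    "\<And>i. i < length \<pi> \<Longrightarrow> Rlin_step X (A \<union> B) (set (take i \<pi>)) (\<pi> ! i)"
    "\<And>D. D \<in> set \<pi> \<Longrightarrow> R0lin_line c d D"
    using ref by (auto simp: R0lin_refutation_def Rlin_refutation_def disj_over_def in_set_conv_nth)
  have "\<forall>D. \<exists>fs. D \<in> set \<pi> \<longrightarrow> represents d S D fs \<and> (D = {} \<longrightarrow> fs = [])"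
    using \<pi>(3,5) disj_size_le_proof_size R0lin_line_represents unfolding S_def by blast
  then obtain forms where forms: "\<And>D. D \<in> set \<pi> \<Longrightarrow> represents d S D (forms D)"
    "\<And>D. D \<in> set \<pi> \<Longrightarrow> D = {} \<Longrightarrow> forms D = []"
    by metis
  let ?m = "card (types d S) * card (types d S) * separator_cost d S"
  obtain F where F: "realizable (length ps) F (card (set \<pi>) * ?m)"
    "\<And>D. D \<in> set \<pi> \<Longrightarrow> separated d S forms F D"
    using realizable_separators[of \<pi> d S forms X "length \<pi>"] forms(1) \<pi>(4) by auto
  have empty: "{} \<in> set \<pi>" using \<pi>(1,2) last_in_set by force
  then have nil: "forms {} = []" using forms(2) by blast
  \<comment> \<open>The empty line has no forms, so its only value vector is \<open>[]\<close>. It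
    is falsified there, and all solutions of both players share this vector.\<close>
  have "[] \<in> types d S" by (simp add: types_def)
  then obtain f where f: "f \<in> F" "separator forms f {} [] []"
    using F(2)[OF empty] nil unfolding separated_def by (auto simp: falsified_def)
  obtain C where C: "circuit_over (length ps) C" "circuit_size C \<le> card (set \<pi>) * ?m"
    "\<And>u. length u = length ps \<Longrightarrow> circuit_eval C u = f u"
    using realizable_circuit[OF F(1) f(1)] by blast
  have "card (set \<pi>) * ?m \<le> (S + 2) * ?m"
    unfolding S_def using card_set_le_proof_size \<pi>(3) by (intro mult_le_mono) auto
  then have "circuit_size C \<le> (S + 2) * ?m" using C(2) by linarith
  moreover have "separates C (extendable ps qs A) (extendable ps rs B)"
    using f(2) C(3) unfolding separates_def extendable_A extendable_B
    by (auto simp: separator_def side_A_def side_B_def nil form_vals_def sols_A_def sols_B_def)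
  ultimately show ?thesis using that C(1) by blast
qed

theorem theorem7p8:
  fixes c d :: nat
  shows "\<exists>f :: nat poly.
    \<forall>(ps :: nat list) (qs :: nat list) (rs :: nat list)
      (A :: nat disj list) (B :: nat disj list) (\<pi> :: nat disj list).
      distinct (ps @ qs @ rs) \<longrightarrow>
      (\<forall>D \<in> set A. disj_over (set ps \<union> set qs) D) \<longrightarrow>
      (\<forall>D \<in> set B. disj_over (set ps \<union> set rs) D) \<longrightarrow>
      R0lin_refutation c d (set ps \<union> set qs \<union> set rs) (set A \<union> set B) \<pi> \<longrightarrow>
      (\<exists>C. circuit_over (length ps) C \<and>
           circuit_size C \<le> poly f (proof_size \<pi>) \<and>
           separates C (extendable ps qs (set A)) (extendable ps rs (set B)))"
proof -
  \<comment> \<open>\<open>N\<close> and \<open>M\<close> evaluate at \<open>S\<close> to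
    \<open>card (types d S)\<close> and \<open>separator_cost d S\<close>; the factor
    \<open>[:2, 1:]\<close> accounts for the at most \<open>S + 2\<close> distinct lines. None of
    them depends on the instance.\<close>
  define N :: "nat poly" where "N = (\<Sum>i \<le> d. [:1, 2:] ^ i)"
  define M :: "nat poly" where
    "M = N * N * (N * N + 2) + of_nat d * ([:1, 1:] * [:8, 12:] + [:3, 4:] + 1) + 1"
  have N: "poly N S = card (types d S)" for S
    by (simp add: N_def card_types poly_sum mult.commute)
  have f: "poly ([:2, 1:] * (N * N * M)) S = (S + 2) *
      (card (types d S) * card (types d S) * separator_cost d S)" for S
    by (simp add: separator_cost_def M_def N algebra_simps)
  show ?thesis
  proof (intro exI[of _ "[:2, 1:] * (N * N * M)"] allI impI)
    fix ps qs rs :: "nat list" and A B \<pi> :: "nat disj list"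
    assume "distinct (ps @ qs @ rs)" "\<forall>D \<in> set A. disj_over (set ps \<union> set qs) D"
      "\<forall>D \<in> set B. disj_over (set ps \<union> set rs) D"
    then interpret interpolation ps qs rs "set A" "set B"
      by unfold_locales auto
    assume "R0lin_refutation c d (set ps \<union> set qs \<union> set rs) (set A \<union> set B) \<pi>"
    then obtain C where C: "circuit_over (length ps) C"
      "circuit_size C \<le> (proof_size \<pi> + 2) * (card (types d (proof_size \<pi>)) *
        card (types d (proof_size \<pi>)) * separator_cost d (proof_size \<pi>))"
      "separates C (extendable ps qs (set A)) (extendable ps rs (set B))"
      by (rule interpolant_circuit)
    then show "\<exists>C. circuit_over (length ps) C \<and>
        circuit_size C \<le> poly ([:2, 1:] * (N * N * M)) (proof_size \<pi>) \<and>
        separates C (extendable ps qs (set A)) (extendable ps rs (set B))"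
      unfolding f by blast
  qed
qed

end
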